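(* For any $\sigma\in\mathfrak S_n$, with $\tau=\Phi(\sigma)$, $$\mathrm{dp}(\sigma)=\ell_T(\sigma)+[2,31](\tau)+[41,32](\tau)+[31,42](\tau)+B(\tau)+C(\tau).$$
   Context: $\mathrm{dp}(\sigma)=\sum_{i:\sigma_i>i}(\sigma_i-i)$; $\ell_T(\sigma)=n-(\text{number of cycles of }\sigma)$. The fundamental bijection $\Phi$: write $\sigma$ in cycle notation with each cycle beginning with its largest element and cycles ordered by increasing largest element; erasing parentheses gives the one-line notation of $\Phi(\sigma)$. For $\tau=\Phi(\sigma)$ (positions range over $1,\dots,n$ with all indices in range): $[2,31](\tau)$ = number of pairs $i<j$ with $\tau_{j+1}<\tau_i<\tau_j$; $[41,32](\tau)$ = number of pairs $i,j$ with $i+1<j$ and $\tau_{i+1}<\tau_{j+1}<\tau_j<\tau_i$; $[31,42](\tau)$ = number of pairs $i,j$ with $i+1<j$ and $\tau_{i+1}<\tau_{j+1}<\tau_i<\tau_j$; $B(\tau)$ = number of pairs $i<j$ with $\tau_i<\tau_j<\tau_{j+1}<\sigma(\tau_i)$; $C(\tau)$ = number of pairs $i<j$ with $\tau_j<\tau_i<\tau_{j+1}<\sigma(\tau_i)$. *)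

theory Defs
  imports "HOL-Combinatorics.Cycles" "HOL-Combinatorics.Orbits"
begin

text \<open>
  An element of the symmetric group on n letters is a function s on the naturals with
  \<^term>\<open>s permutes {1..n}\<close>; thus positions and values both range over \<^term>\<open>{1..n}\<close>, and
  its one-line notation is s 1, ..., s n.
\<close>

definition dp :: "nat \<Rightarrow> (nat \<Rightarrow> nat) \<Rightarrow> nat" where
  "dp n \<sigma> = (\<Sum>i\<in>{i\<in>{1..n}. \<sigma> i > i}. \<sigma> i - i)"

text \<open>The underlying sets of the cycles, with one singleton for each fixed point in \<^term>\<open>{1..n}\<close>.\<close>

definition cycle_sets :: "nat \<Rightarrow> (nat \<Rightarrow> nat) \<Rightarrow> nat set set" where
  "cycle_sets n \<sigma> = orbit \<sigma> ` {1..n}"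

text \<open>The subtraction below never truncates:\<close>

lemma card_cycle_sets_le: "card (cycle_sets n \<sigma>) \<le> n"
  unfolding cycle_sets_def using card_image_le[of "{1..n}" "orbit \<sigma>"] by simp

definition refl_length :: "nat \<Rightarrow> (nat \<Rightarrow> nat) \<Rightarrow> nat" where
  "refl_length n \<sigma> = n - card (cycle_sets n \<sigma>)"

text \<open>
  Each cycle is written as m, s m, s (s m), ... starting from its largest element m
  (this is \<^term>\<open>support \<sigma> m\<close>), and the cycles are listed by increasing m.
\<close>

definition cycle_notation :: "nat \<Rightarrow> (nat \<Rightarrow> nat) \<Rightarrow> nat list list" where
  "cycle_notation n \<sigma> = map (support \<sigma>) (sorted_list_of_set (Max ` cycle_sets n \<sigma>))"

text \<open>The fundamental bijection; list positions start at 0, whence the shift.\<close>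

definition fundamental :: "nat \<Rightarrow> (nat \<Rightarrow> nat) \<Rightarrow> nat \<Rightarrow> nat" where
  "fundamental n \<sigma> i = (if i \<in> {1..n} then concat (cycle_notation n \<sigma>) ! (i - 1) else i)"

text \<open>
  The five statistics count pairs of positions; the bound \<^term>\<open>j + 1 \<le> n\<close> keeps every index
  (including i + 1 where it occurs) in \<^term>\<open>{1..n}\<close>.
\<close>

definition pat_2_31 :: "nat \<Rightarrow> (nat \<Rightarrow> nat) \<Rightarrow> nat" where
  "pat_2_31 n \<tau> = card {(i, j). 1 \<le> i \<and> i < j \<and> j + 1 \<le> n \<and>
     \<tau> (j + 1) < \<tau> i \<and> \<tau> i < \<tau> j}"

definition pat_41_32 :: "nat \<Rightarrow> (nat \<Rightarrow> nat) \<Rightarrow> nat" where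
  "pat_41_32 n \<tau> = card {(i, j). 1 \<le> i \<and> i + 1 < j \<and> j + 1 \<le> n \<and>
     \<tau> (i + 1) < \<tau> (j + 1) \<and> \<tau> (j + 1) < \<tau> j \<and> \<tau> j < \<tau> i}"

definition pat_31_42 :: "nat \<Rightarrow> (nat \<Rightarrow> nat) \<Rightarrow> nat" where
  "pat_31_42 n \<tau> = card {(i, j). 1 \<le> i \<and> i + 1 < j \<and> j + 1 \<le> n \<and>
     \<tau> (i + 1) < \<tau> (j + 1) \<and> \<tau> (j + 1) < \<tau> i \<and> \<tau> i < \<tau> j}"

text \<open>
  The last two statistics also refer to the permutation \<open>\<sigma>\<close> whose image under the
  fundamental bijection is \<open>\<tau>\<close>; it is passed explicitly.
\<close>

definition stat_B :: "nat \<Rightarrow> (nat \<Rightarrow> nat) \<Rightarrow> (nat \<Rightarrow> nat) \<Rightarrow> nat" where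
  "stat_B n \<sigma> \<tau> = card {(i, j). 1 \<le> i \<and> i < j \<and> j + 1 \<le> n \<and>
     \<tau> i < \<tau> j \<and> \<tau> j < \<tau> (j + 1) \<and> \<tau> (j + 1) < \<sigma> (\<tau> i)}"

definition stat_C :: "nat \<Rightarrow> (nat \<Rightarrow> nat) \<Rightarrow> (nat \<Rightarrow> nat) \<Rightarrow> nat" where
  "stat_C n \<sigma> \<tau> = card {(i, j). 1 \<le> i \<and> i < j \<and> j + 1 \<le> n \<and>
     \<tau> j < \<tau> i \<and> \<tau> i < \<tau> (j + 1) \<and> \<tau> (j + 1) < \<sigma> (\<tau> i)}"

end

theory Submission
  imports Defs
begin

text \<open>
  Excedances and deficits of \<open>\<sigma>\<close> have the same total size, and the deficits are exactly the descents
  of \<open>\<tau>\<close>; so dp is the sum of the descent drops \<open>\<tau>\<^sub>j - \<tau>\<^sub>j\<^sub>+\<^sub>1\<close>. Sorting the values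
  strictly between the two letters of a descent by their position gives
  dp = des + [2,31] + [31,2]. In an occurrence of [31,2] the letter playing 2 ends either a descent,
  which yields [41,32] + [31,42], or an ascent. For an ascent with top \<open>w\<close>, the occurrences count the
  earlier letters whose step under \<open>\<sigma>\<close> crosses the level \<open>w\<close> downwards. They exceed those
  crossing upwards, counted by B + C, by one if \<open>w\<close> does not start a cycle, and by zero otherwise.
  The descents and the ascents of this first kind together number the letters that
  do not start a cycle, which is the reflection length.
\<close>

section \<open>Counting pairs by one coordinate\<close>

lemma card_pairs_snd:
  assumes "finite J" "\<And>i j. P i j \<Longrightarrow> j \<in> J" "\<And>j. j \<in> J \<Longrightarrow> finite {i. P i j}"
  shows "card {(i, j). P i j} = (\<Sum>j\<in>J. card {i. P i j})"
proof -
  have "{(i, j). P i j} = (\<lambda>(j, i). (i, j)) ` (SIGMA j:J. {i. P i j})"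
    using assms(2) by (auto simp: image_iff)
  moreover have "inj_on (\<lambda>(j, i). (i, j)) (SIGMA j:J. {i. P i j})"
    by (auto simp: inj_on_def)
  ultimately show ?thesis
    using assms by (simp add: card_image card_SigmaI)
qed

lemma card_pairs_fst:
  assumes "finite I" "\<And>i j. P i j \<Longrightarrow> i \<in> I" "\<And>i. i \<in> I \<Longrightarrow> finite {j. P i j}"
  shows "card {(i, j). P i j} = (\<Sum>i\<in>I. card {j. P i j})"
proof -
  have "{(i, j). P i j} = (SIGMA i:I. {j. P i j})"
    using assms(2) by auto
  then show ?thesis
    using assms by (simp add: card_SigmaI)
qed

text \<open>The intermediate pattern [31,2]. Its last letter has no prescribed neighbour, so
  \<open>k\<close> may be the last position \<open>n\<close>.\<close>

definition pat_31_2 :: "nat \<Rightarrow> (nat \<Rightarrow> nat) \<Rightarrow> nat" where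
  "pat_31_2 n \<tau> = card {(i, k). 1 \<le> i \<and> i + 1 < k \<and> k \<le> n \<and>
     \<tau> (i + 1) < \<tau> k \<and> \<tau> k < \<tau> i}"

text \<open>
  \<open>L\<close> is the set of positions at which the cycles of \<open>\<sigma>\<close> start in the word \<open>\<tau>\<close>.
\<close>

locale cycle_word =
  fixes n :: nat and \<sigma> \<tau> :: "nat \<Rightarrow> nat" and L :: "nat set"
  assumes permutes: "\<sigma> permutes {1..n}"
    and word: "bij_betw \<tau> {1..n} {1..n}"
    and starts: "L \<subseteq> {1..n}"
    and start_greater: "\<And>p q. p \<in> L \<Longrightarrow> q \<in> {1..<p} \<Longrightarrow> \<tau> q < \<tau> p"
    and start_prefix: "\<And>p. p \<in> L \<Longrightarrow> \<sigma> ` \<tau> ` {1..<p} = \<tau> ` {1..<p}"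
    and inner: "\<And>p. p \<in> {1..n} - L \<Longrightarrow> \<sigma> (\<tau> (p - 1)) = \<tau> p"
    and inner_prefix: "\<And>p. p \<in> {1..n} - L \<Longrightarrow> \<exists>m\<in>\<tau> ` {1..<p}. \<tau> p < m \<and>
      \<sigma> ` \<tau> ` {1..<p} = insert (\<tau> p) (\<tau> ` {1..<p} - {m})"
    and deficit_next: "\<And>i. i \<in> {1..n} \<Longrightarrow> \<sigma> (\<tau> i) < \<tau> i \<Longrightarrow> i < n \<and> \<sigma> (\<tau> i) = \<tau> (Suc i)"
begin

lemma \<tau>_inj: "i \<in> {1..n} \<Longrightarrow> j \<in> {1..n} \<Longrightarrow> \<tau> i = \<tau> j \<longleftrightarrow> i = j"
  using word unfolding bij_betw_def inj_on_def by blast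

lemma \<sigma>_inj: "inj \<sigma>"
  using permutes permutes_inj by blast

section \<open>Descents and the total drop\<close>

definition descents :: "nat set" where
  "descents = {j. 1 \<le> j \<and> Suc j \<le> n \<and> \<tau> (Suc j) < \<tau> j}"

definition ascents :: "nat set" where
  "ascents = {j. 1 \<le> j \<and> Suc j \<le> n \<and> \<tau> j < \<tau> (Suc j)}"

lemma finite_descents [simp]: "finite descents"
  by (rule finite_subset[of _ "{1..n}"]) (auto simp: descents_def)

lemma finite_ascents [simp]: "finite ascents"
  by (rule finite_subset[of _ "{1..n}"]) (auto simp: ascents_def)

lemma descents_ascents: "descents \<union> ascents = {1..<n}" "descents \<inter> ascents = {}"
proof -
  have "\<tau> j \<noteq> \<tau> (Suc j)" if "1 \<le> j" "Suc j \<le> n" for j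
    using \<tau>_inj[of j "Suc j"] that by auto
  then show "descents \<union> ascents = {1..<n}"
    unfolding descents_def ascents_def by (force simp: linorder_neq_iff)
qed (auto simp: descents_def ascents_def)

text \<open>Cycles start at left-to-right maxima of the word, and a descent cannot end at
  one.\<close>

lemma descent_not_start: "j \<in> descents \<Longrightarrow> Suc j \<notin> L"
  using start_greater[of "Suc j" j] by (auto simp: descents_def)

lemma dp_eq_sum_descents: "dp n \<sigma> = (\<Sum>j\<in>descents. \<tau> j - \<tau> (Suc j))"
proof -
  have "dp n \<sigma> = (\<Sum>i\<in>{1..n}. \<sigma> i - i)"
    unfolding dp_def by (rule sum.mono_neutral_left) auto
  also have "\<dots> = (\<Sum>i\<in>{1..n}. i - \<sigma> i)"
  proof -
    \<comment> \<open>With truncated subtraction both summands equal the larger of \<open>i\<close>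
      and \<open>\<sigma> i\<close>.\<close>
    have "(\<Sum>i\<in>{1..n}. \<sigma> i - i) + (\<Sum>i\<in>{1..n}. i) = (\<Sum>i\<in>{1..n}. i - \<sigma> i) + (\<Sum>i\<in>{1..n}. \<sigma> i)"
      unfolding sum.distrib[symmetric] by (rule sum.cong) auto
    moreover have "(\<Sum>i\<in>{1..n}. \<sigma> i) = (\<Sum>i\<in>{1..n}. i)"
      using sum.permute[OF permutes, of "\<lambda>i. i"] by (simp add: o_def)
    ultimately show ?thesis by simp
  qed
  also have "\<dots> = (\<Sum>j\<in>{1..n}. \<tau> j - \<sigma> (\<tau> j))"
    using sum.reindex_bij_betw[OF word, of "\<lambda>i. i - \<sigma> i"] by simp
  also have "\<dots> = (\<Sum>j\<in>descents. \<tau> j - \<sigma> (\<tau> j))"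
  proof (rule sum.mono_neutral_right)
    show "descents \<subseteq> {1..n}" by (auto simp: descents_def)
    \<comment> \<open>A letter above its image is followed by that image, so its position is a
      descent; elsewhere the difference truncates to 0.\<close>
    show "\<forall>j\<in>{1..n} - descents. \<tau> j - \<sigma> (\<tau> j) = 0"
      using deficit_next unfolding descents_def by fastforce
  qed simp
  also have "\<dots> = (\<Sum>j\<in>descents. \<tau> j - \<tau> (Suc j))"
  proof (rule sum.cong)
    fix j assume j: "j \<in> descents"
    then have "Suc j \<in> {1..n} - L"
      using descent_not_start by (auto simp: descents_def)
    from inner[OF this] show "\<tau> j - \<sigma> (\<tau> j) = \<tau> j - \<tau> (Suc j)" by simp
  qed simp
  finally show ?thesis .
qed

text \<open>Each value strictly between the two letters of the descent occurs exactly once in the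
  word, either before position \<open>j\<close> or after \<open>Suc j\<close>.\<close>

lemma descent_drop:
  assumes "j \<in> descents"
  shows "\<tau> j - \<tau> (Suc j) = 1 + card {i. 1 \<le> i \<and> i < j \<and> \<tau> (Suc j) < \<tau> i \<and> \<tau> i < \<tau> j}
    + card {k. Suc j < k \<and> k \<le> n \<and> \<tau> (Suc j) < \<tau> k \<and> \<tau> k < \<tau> j}" (is "_ = 1 + card ?A + card ?B")
proof -
  have j: "1 \<le> j" "Suc j \<le> n" "\<tau> (Suc j) < \<tau> j"
    using assms by (auto simp: descents_def)
  have fin: "finite ?A" "finite ?B"
    by (rule finite_subset[of _ "{..n}"], use j in auto)+
  have range: "\<tau> j \<in> {1..n}" "\<tau> (Suc j) \<in> {1..n}"
    using word j by (auto dest!: bij_betwE)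
  have "{\<tau> (Suc j)<..<\<tau> j} = \<tau> ` (?A \<union> ?B)"
  proof
    show "{\<tau> (Suc j)<..<\<tau> j} \<subseteq> \<tau> ` (?A \<union> ?B)"
    proof
      fix v assume v: "v \<in> {\<tau> (Suc j)<..<\<tau> j}"
      then have "v \<in> \<tau> ` {1..n}"
        using word range unfolding bij_betw_def by auto
      then obtain k where k: "k \<in> {1..n}" "v = \<tau> k" by blast
      then have "k \<noteq> j" "k \<noteq> Suc j" using v by auto
      then have "k < j \<or> Suc j < k" by linarith
      then show "v \<in> \<tau> ` (?A \<union> ?B)" using k v by auto
    qed
  qed auto
  moreover have "inj_on \<tau> (?A \<union> ?B)"
    by (rule inj_on_subset[of \<tau> "{1..n}"]) (use word j in \<open>auto simp: bij_betw_def\<close>)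
  ultimately have "card {\<tau> (Suc j)<..<\<tau> j} = card (?A \<union> ?B)"
    by (simp add: card_image)
  also have "\<dots> = card ?A + card ?B"
    using fin by (intro card_Un_disjoint) auto
  finally show ?thesis using j by simp
qed

text \<open>For each descent, the intermediate values placed earlier are the letters 2 of [2,31],
  those placed later the letters 2 of [31,2], and the remaining 1 counts the descent itself.\<close>

lemma dp_eq_descents_patterns: "dp n \<sigma> = card descents + pat_2_31 n \<tau> + pat_31_2 n \<tau>"
proof -
  have "pat_2_31 n \<tau> = (\<Sum>j\<in>descents. card {i. 1 \<le> i \<and> i < j \<and> j + 1 \<le> n \<and> \<tau> (j + 1) < \<tau> i \<and> \<tau> i < \<tau> j})"
    unfolding pat_2_31_def
    by (intro card_pairs_snd finite_descents) (auto simp: descents_def)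
  also have "\<dots> = (\<Sum>j\<in>descents. card {i. 1 \<le> i \<and> i < j \<and> \<tau> (Suc j) < \<tau> i \<and> \<tau> i < \<tau> j})"
    by (intro sum.cong arg_cong[of _ _ card]) (auto simp: descents_def)
  finally have A: "pat_2_31 n \<tau> = \<dots>" .
  have "pat_31_2 n \<tau> = (\<Sum>j\<in>descents. card {k. 1 \<le> j \<and> j + 1 < k \<and> k \<le> n \<and> \<tau> (j + 1) < \<tau> k \<and> \<tau> k < \<tau> j})"
    unfolding pat_31_2_def
    by (intro card_pairs_fst finite_descents) (auto simp: descents_def)
  also have "\<dots> = (\<Sum>j\<in>descents. card {k. Suc j < k \<and> k \<le> n \<and> \<tau> (Suc j) < \<tau> k \<and> \<tau> k < \<tau> j})"
    by (intro sum.cong arg_cong[of _ _ card]) (auto simp: descents_def)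
  finally have B: "pat_31_2 n \<tau> = \<dots>" .
  show ?thesis
    unfolding A B dp_eq_sum_descents card_eq_sum sum.distrib[symmetric] One_nat_def[symmetric]
    by (rule sum.cong[OF refl]) (simp only: descent_drop card_eq_sum)
qed

section \<open>Crossings of the level of an entry\<close>

text \<open>These are the descents playing 31 when the entry at \<open>Suc j\<close> plays 2:
  downward crossings of its level.\<close>

definition straddling :: "nat \<Rightarrow> nat set" where
  "straddling j = {i. 1 \<le> i \<and> i < j \<and> \<tau> (Suc i) < \<tau> (Suc j) \<and> \<tau> (Suc j) < \<tau> i}"

text \<open>Upward crossings of the same level. They are stated with \<open>\<sigma>\<close> because
  the last letter of a cycle may rise to the start of its cycle, which is not the next entry of the
  word.\<close>

definition exceeding :: "nat \<Rightarrow> nat set" where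
  "exceeding j = {i. 1 \<le> i \<and> i < j \<and> \<tau> i < \<tau> (Suc j) \<and> \<tau> (Suc j) < \<sigma> (\<tau> i)}"

lemma finite_straddling [simp]: "finite (straddling j)"
  by (rule finite_subset[of _ "{..j}"]) (auto simp: straddling_def)

lemma finite_exceeding [simp]: "finite (exceeding j)"
  by (rule finite_subset[of _ "{..j}"]) (auto simp: exceeding_def)

text \<open>The letter 2 is never first, so its position is \<open>Suc j\<close> for an adjacent
  pair starting at \<open>j\<close>, which is a descent or an ascent.\<close>

lemma pat_31_2_eq: "pat_31_2 n \<tau> = (\<Sum>j\<in>descents. card (straddling j)) + (\<Sum>j\<in>ascents. card (straddling j))"
proof -
  have "pat_31_2 n \<tau> = (\<Sum>k\<in>Suc ` {1..<n}. card {i. 1 \<le> i \<and> i + 1 < k \<and> k \<le> n \<and> \<tau> (i + 1) < \<tau> k \<and> \<tau> k < \<tau> i})"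
    unfolding pat_31_2_def image_Suc_atLeastLessThan
    by (intro card_pairs_snd) (auto intro: finite_subset[of _ "{..n}"])
  also have "\<dots> = (\<Sum>j\<in>{1..<n}. card (straddling j))"
    unfolding sum.reindex[OF inj_Suc] o_def
    by (intro sum.cong arg_cong[of _ _ card]) (auto simp: straddling_def)
  finally show ?thesis
    unfolding descents_ascents(1)[symmetric] by (simp add: sum.union_disjoint descents_ascents(2))
qed

text \<open>When the letter 2 ends a descent, comparing the top \<open>\<tau> j\<close> of this
  descent with \<open>\<tau> i\<close> decides between the two patterns.\<close>

lemma straddling_descents: "(\<Sum>j\<in>descents. card (straddling j)) = pat_41_32 n \<tau> + pat_31_42 n \<tau>"
proof -
  define P where "P i j \<longleftrightarrow> 1 \<le> i \<and> i + 1 < j \<and> j + 1 \<le> n \<and>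
     \<tau> (i + 1) < \<tau> (j + 1) \<and> \<tau> (j + 1) < \<tau> j \<and> \<tau> j < \<tau> i" for i j
  define Q where "Q i j \<longleftrightarrow> 1 \<le> i \<and> i + 1 < j \<and> j + 1 \<le> n \<and>
     \<tau> (i + 1) < \<tau> (j + 1) \<and> \<tau> (j + 1) < \<tau> i \<and> \<tau> i < \<tau> j" for i j
  have fin: "finite {i. P i j}" "finite {i. Q i j}" for j
    by (rule finite_subset[of _ "{..j}"], auto simp: P_def Q_def)+
  have "pat_41_32 n \<tau> = (\<Sum>j\<in>descents. card {i. P i j})"
    unfolding pat_41_32_def P_def[symmetric]
    by (intro card_pairs_snd fin finite_descents) (auto simp: descents_def P_def)
  moreover have "pat_31_42 n \<tau> = (\<Sum>j\<in>descents. card {i. Q i j})"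
    unfolding pat_31_42_def Q_def[symmetric]
    by (intro card_pairs_snd fin finite_descents) (auto simp: descents_def Q_def)
  moreover have "card (straddling j) = card {i. P i j} + card {i. Q i j}" if j: "j \<in> descents" for j
  proof -
    have "straddling j = {i. P i j} \<union> {i. Q i j}"
    proof (intro subset_antisym subsetI)
      fix i assume i: "i \<in> straddling j"
      \<comment> \<open>If \<open>Suc i = j\<close>, the entry at \<open>j\<close> would be smaller
        than the one at \<open>Suc j\<close>. This yields the bound \<open>i + 1 < j\<close> of the
        patterns.\<close>
      then have "\<tau> i \<noteq> \<tau> j" "Suc i \<noteq> j"
        using j \<tau>_inj[of i j] by (auto simp: straddling_def descents_def)
      then show "i \<in> {i. P i j} \<union> {i. Q i j}"
        using i j by (auto simp: straddling_def descents_def P_def Q_def)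
    qed (use j in \<open>auto simp: straddling_def descents_def P_def Q_def\<close>)
    moreover have "{i. P i j} \<inter> {i. Q i j} = {}" by (auto simp: P_def Q_def)
    ultimately show ?thesis using card_Un_disjoint[OF fin] by simp
  qed
  ultimately show ?thesis by (simp add: sum.distrib)
qed

text \<open>B and C differ only in whether \<open>\<tau> i\<close> lies below or above the bottom
  \<open>\<tau> j\<close> of the ascent.\<close>

lemma exceeding_ascents: "(\<Sum>j\<in>ascents. card (exceeding j)) = stat_B n \<sigma> \<tau> + stat_C n \<sigma> \<tau>"
proof -
  define P where "P i j \<longleftrightarrow> 1 \<le> i \<and> i < j \<and> j + 1 \<le> n \<and>
     \<tau> i < \<tau> j \<and> \<tau> j < \<tau> (j + 1) \<and> \<tau> (j + 1) < \<sigma> (\<tau> i)" for i j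
  define Q where "Q i j \<longleftrightarrow> 1 \<le> i \<and> i < j \<and> j + 1 \<le> n \<and>
     \<tau> j < \<tau> i \<and> \<tau> i < \<tau> (j + 1) \<and> \<tau> (j + 1) < \<sigma> (\<tau> i)" for i j
  have fin: "finite {i. P i j}" "finite {i. Q i j}" for j
    by (rule finite_subset[of _ "{..j}"], auto simp: P_def Q_def)+
  have "stat_B n \<sigma> \<tau> = (\<Sum>j\<in>ascents. card {i. P i j})"
    unfolding stat_B_def P_def[symmetric]
    by (intro card_pairs_snd fin finite_ascents) (auto simp: ascents_def P_def)
  moreover have "stat_C n \<sigma> \<tau> = (\<Sum>j\<in>ascents. card {i. Q i j})"
    unfolding stat_C_def Q_def[symmetric]
    by (intro card_pairs_snd fin finite_ascents) (auto simp: ascents_def Q_def)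
  moreover have "card (exceeding j) = card {i. P i j} + card {i. Q i j}" if j: "j \<in> ascents" for j
  proof -
    have "exceeding j = {i. P i j} \<union> {i. Q i j}"
    proof (intro subset_antisym subsetI)
      fix i assume i: "i \<in> exceeding j"
      then have "\<tau> i \<noteq> \<tau> j"
        using j \<tau>_inj[of i j] by (auto simp: exceeding_def ascents_def)
      then show "i \<in> {i. P i j} \<union> {i. Q i j}"
        using i j by (auto simp: exceeding_def ascents_def P_def Q_def)
    qed (use j in \<open>auto simp: exceeding_def ascents_def P_def Q_def\<close>)
    moreover have "{i. P i j} \<inter> {i. Q i j} = {}" by (auto simp: P_def Q_def)
    ultimately show ?thesis using card_Un_disjoint[OF fin] by simp
  qed
  ultimately show ?thesis by (simp add: sum.distrib)
qed

text \<open>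
  Let \<open>S\<close> be the set of letters at positions up to \<open>j\<close> and \<open>w\<close> the entry after it. Counting the elements above \<open>w\<close>
  in \<open>S\<close> and in \<open>\<sigma> ` S\<close> compares the crossings of the level \<open>w\<close> in the two directions: the two
  counts agree when \<open>w\<close> starts a cycle, and otherwise \<open>\<sigma> ` S\<close> only loses the maximum of the
  current cycle.
\<close>

lemma card_straddling_ascent:
  assumes "j \<in> ascents"
  shows "card (straddling j) = card (exceeding j) + (if Suc j \<in> L then 0 else 1)"
proof -
  define w where "w = \<tau> (Suc j)"
  define S where "S = \<tau> ` {1..<Suc j}"
  have j: "1 \<le> j" "Suc j \<le> n" "\<tau> j < w"
    using assms by (auto simp: ascents_def w_def)
  have fin: "finite S" by (simp add: S_def)
  have injS: "inj_on \<tau> {1..<Suc j}"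
    by (rule inj_on_subset[of \<tau> "{1..n}"]) (use word j in \<open>auto simp: bij_betw_def\<close>)
  have next_eq: "\<sigma> (\<tau> i) = \<tau> (Suc i)" if "i \<in> {1..j}" "\<tau> (Suc i) < \<tau> i" for i
  proof -
    have "i \<in> descents" using that j by (auto simp: descents_def)
    with inner[of "Suc i"] descent_not_start that j show ?thesis by auto
  qed
  \<comment> \<open>The case \<open>\<sigma> a = w\<close> is void: a letter above \<open>w\<close>
    with image \<open>w\<close> would have to be the entry before \<open>w\<close>, which is smaller
    at an ascent.\<close>
  have down: "{a \<in> S. w < a \<and> \<sigma> a \<le> w} = \<tau> ` straddling j"
  proof (intro subset_antisym subsetI)
    fix a assume a: "a \<in> {a \<in> S. w < a \<and> \<sigma> a \<le> w}"
    then obtain i where i: "i \<in> {1..<Suc j}" "a = \<tau> i" by (auto simp: S_def)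
    with a j have ij: "i < j" by (cases "i = j") auto
    from a i deficit_next[of i] j have eq: "\<sigma> a = \<tau> (Suc i)" by auto
    moreover have "\<tau> (Suc i) \<noteq> w"
      using \<tau>_inj[of "Suc i" "Suc j"] ij i j by (auto simp: w_def)
    ultimately show "a \<in> \<tau> ` straddling j"
      using a i ij by (auto simp: straddling_def w_def)
  next
    fix a assume "a \<in> \<tau> ` straddling j"
    then show "a \<in> {a \<in> S. w < a \<and> \<sigma> a \<le> w}"
      using next_eq by (fastforce simp: straddling_def w_def S_def)
  qed
  \<comment> \<open>This rules out position \<open>j\<close> as an upward crossing: the image of
    \<open>\<tau> j\<close> is \<open>w\<close> itself, or a letter of the prefix and then below the
    cycle start \<open>w\<close>.\<close>
  have last: "\<not> w < \<sigma> (\<tau> j)"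
  proof (cases "Suc j \<in> L")
    case True
    have "\<sigma> (\<tau> j) \<in> \<tau> ` {1..<Suc j}"
      using start_prefix[OF True] j by auto
    then show ?thesis using start_greater[OF True] by (fastforce simp: w_def)
  next
    case False
    then show ?thesis using inner[of "Suc j"] j by (auto simp: w_def)
  qed
  have up: "{a \<in> S. a < w \<and> w < \<sigma> a} = \<tau> ` exceeding j"
  proof (intro subset_antisym subsetI)
    fix a assume a: "a \<in> {a \<in> S. a < w \<and> w < \<sigma> a}"
    then obtain i where i: "i \<in> {1..<Suc j}" "a = \<tau> i" by (auto simp: S_def)
    with a last have "i < j" by (cases "i = j") auto
    then show "a \<in> \<tau> ` exceeding j"
      using a i by (auto simp: exceeding_def w_def)
  qed (auto simp: exceeding_def w_def S_def)
  have wS: "w \<notin> S"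
    using \<tau>_inj[of "Suc j"] j by (fastforce simp: w_def S_def)
  have card_\<tau>: "card (\<tau> ` A) = card A" if "A \<subseteq> {1..<Suc j}" for A
    using injS that by (intro card_image) (rule inj_on_subset)
  \<comment> \<open>The letters that stay above \<open>w\<close> enter both this count and the next
    one, and will cancel.\<close>
  have "{a \<in> S. w < a} = \<tau> ` straddling j \<union> {a \<in> S. w < a \<and> w < \<sigma> a}"
    unfolding down[symmetric] by auto
  also have "card \<dots> = card (\<tau> ` straddling j) + card {a \<in> S. w < a \<and> w < \<sigma> a}"
    using fin unfolding down[symmetric] by (intro card_Un_disjoint) auto
  finally have 1: "card {a \<in> S. w < a} = card (straddling j) + card {a \<in> S. w < a \<and> w < \<sigma> a}"
    by (subst (asm) card_\<tau>) (auto simp: straddling_def)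
  have "{a \<in> S. w < \<sigma> a} = \<tau> ` exceeding j \<union> {a \<in> S. w < a \<and> w < \<sigma> a}"
    using wS unfolding up[symmetric] by (auto intro: linorder_neqE_nat)
  also have "card \<dots> = card (\<tau> ` exceeding j) + card {a \<in> S. w < a \<and> w < \<sigma> a}"
    using fin unfolding up[symmetric] by (intro card_Un_disjoint) auto
  finally have 2: "card {a \<in> S. w < \<sigma> a} = card (exceeding j) + card {a \<in> S. w < a \<and> w < \<sigma> a}"
    by (subst (asm) card_\<tau>) (auto simp: exceeding_def)
  have "{b \<in> \<sigma> ` S. w < b} = \<sigma> ` {a \<in> S. w < \<sigma> a}" by auto
  then have 3: "card {b \<in> \<sigma> ` S. w < b} = card {a \<in> S. w < \<sigma> a}"
    using \<sigma>_inj by (simp add: card_image inj_on_subset)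
  have "card {a \<in> S. w < a} = card {b \<in> \<sigma> ` S. w < b} + (if Suc j \<in> L then 0 else 1)"
  proof (cases "Suc j \<in> L")
    case True
    then show ?thesis using start_prefix[OF True] by (simp add: S_def)
  next
    case False
    then obtain m where m: "m \<in> S" "w < m" "\<sigma> ` S = insert w (S - {m})"
      using inner_prefix[of "Suc j"] j by (auto simp: S_def w_def)
    then have "{a \<in> S. w < a} = insert m {b \<in> \<sigma> ` S. w < b}" "m \<notin> {b \<in> \<sigma> ` S. w < b}" by auto
    then show ?thesis using False fin by simp
  qed
  then show ?thesis using 1 2 3 by simp
qed

text \<open>Every position outside \<open>L\<close> is the end of an adjacent pair, since position 1
  is a start; and every descent ends outside \<open>L\<close>.\<close>

lemma descents_plus_inner_ascents: "card descents + card {j \<in> ascents. Suc j \<notin> L} = n - card L"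
proof -
  \<comment> \<open>Otherwise \<open>inner_prefix\<close> would provide an element of the empty
    prefix.\<close>
  have "1 \<in> L" if "1 \<le> n"
    using inner_prefix[of 1] that by auto
  then have "{1..n} - L = {2..n} - L"
    by (intro set_eqI) (metis Diff_iff One_nat_def Suc_1 Suc_leD atLeastAtMost_iff le_antisym not_less_eq_eq order_trans)
  also have "\<dots> = Suc ` {j \<in> {1..<n}. Suc j \<notin> L}"
  proof (intro subset_antisym subsetI)
    fix p assume "p \<in> {2..n} - L"
    then show "p \<in> Suc ` {j \<in> {1..<n}. Suc j \<notin> L}" by (cases p) auto
  qed auto
  also have "{j \<in> {1..<n}. Suc j \<notin> L} = {j \<in> descents \<union> ascents. Suc j \<notin> L}"
    unfolding descents_ascents ..
  also have "{j \<in> descents \<union> ascents. Suc j \<notin> L} = descents \<union> {j \<in> ascents. Suc j \<notin> L}"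
    using descent_not_start by auto
  finally have "card ({1..n} - L) = card (descents \<union> {j \<in> ascents. Suc j \<notin> L})"
    by (simp add: card_image)
  also have "\<dots> = card descents + card {j \<in> ascents. Suc j \<notin> L}"
    using descents_ascents(2) by (intro card_Un_disjoint) auto
  finally show ?thesis
    using starts by (simp add: card_Diff_subset finite_subset)
qed

theorem dp_eq: "dp n \<sigma> = n - card L + pat_2_31 n \<tau> + pat_41_32 n \<tau> + pat_31_42 n \<tau>
    + stat_B n \<sigma> \<tau> + stat_C n \<sigma> \<tau>"
proof -
  have "(\<Sum>j\<in>ascents. card (straddling j)) =
      (\<Sum>j\<in>ascents. card (exceeding j)) + card {j \<in> ascents. Suc j \<notin> L}"
    by (simp add: card_straddling_ascent sum.distrib sum.If_cases Int_def)
  then show ?thesis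
    unfolding dp_eq_descents_patterns pat_31_2_eq straddling_descents exceeding_ascents
    using descents_plus_inner_ascents by simp
qed

end

section \<open>The cycles, their maxima and the word they spell\<close>

text \<open>Locates a position of the word inside its cycle: \<open>f x\<close> is the block
  containing it and \<open>q\<close> the offset there.\<close>

lemma nth_concat_split:
  assumes "p < length (concat (map f xs))"
  obtains ys x zs q where "xs = ys @ x # zs" "q < length (f x)"
    "p = length (concat (map f ys)) + q"
  using assms
proof (induction xs arbitrary: p thesis)
  case (Cons x xs)
  show ?case
  proof (cases "p < length (f x)")
    case True
    then show ?thesis using Cons.prems(1)[of "[]" x xs p] by simp
  next
    case False
    then have "p - length (f x) < length (concat (map f xs))"
      using Cons.prems(2) by auto
    then obtain ys y zs q where "xs = ys @ y # zs" "q < length (f y)"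
      "p - length (f x) = length (concat (map f ys)) + q"
      using Cons.IH by blast
    then show ?thesis using Cons.prems(1)[of "x # ys" y zs q] False by simp
  qed
qed simp

locale interval_permutation =
  fixes n :: nat and \<sigma> :: "nat \<Rightarrow> nat"
  assumes permutes: "\<sigma> permutes {1..n}"
begin

definition maxima :: "nat set" where
  "maxima = Max ` cycle_sets n \<sigma>"

definition letters :: "nat list" where
  "letters = concat (cycle_notation n \<sigma>)"

lemma letters_eq: "letters = concat (map (support \<sigma>) (sorted_list_of_set maxima))"
  by (simp add: letters_def cycle_notation_def maxima_def)

lemma permutation: "permutation \<sigma>"
  using permutes permutation_permutes by blast

lemma set_support: "set (support \<sigma> a) = orbit \<sigma> a"
  using support_set[OF permutation] orbit_altdef_permutation[OF permutation] by auto

lemma self_in_orbit: "a \<in> orbit \<sigma> a"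
  by (rule permutation_self_in_orbit[OF permutation])

lemma orbit_eq: "b \<in> orbit \<sigma> a \<Longrightarrow> orbit \<sigma> b = orbit \<sigma> a"
  by (rule orbit_cyclic_eq3[OF cyclic_on_orbit'[OF permutation]])

lemma finite_orbit: "finite (orbit \<sigma> a)"
  using finite_orbit[OF self_in_orbit] .

lemma image_orbit: "\<sigma> ` orbit \<sigma> a = orbit \<sigma> a"
proof (rule card_subset_eq)
  show "\<sigma> ` orbit \<sigma> a \<subseteq> orbit \<sigma> a" by (auto intro: orbit.step)
  show "card (\<sigma> ` orbit \<sigma> a) = card (orbit \<sigma> a)"
    using permutes_inj[OF permutes] by (simp add: card_image inj_on_subset)
qed (rule finite_orbit)

lemma finite_maxima: "finite maxima"
  by (simp add: maxima_def cycle_sets_def)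

lemma Max_orbit: "Max (orbit \<sigma> a) \<in> orbit \<sigma> a"
  by (rule Max_in[OF finite_orbit orbit_nonempty])

text \<open>The maximum of an orbit belongs to it and therefore generates the same orbit.\<close>

lemma maxima_iff: "m \<in> maxima \<longleftrightarrow> m \<in> {1..n} \<and> m = Max (orbit \<sigma> m)"
proof
  assume "m \<in> maxima"
  then obtain a where a: "a \<in> {1..n}" "m = Max (orbit \<sigma> a)"
    by (auto simp: maxima_def cycle_sets_def)
  then have "m \<in> orbit \<sigma> a" using Max_orbit by simp
  then show "m \<in> {1..n} \<and> m = Max (orbit \<sigma> m)"
    using permutes_orbit_subset[OF permutes a(1)] orbit_eq a(2) by auto
qed (auto simp: maxima_def cycle_sets_def)

lemma maxima_ge: "m \<in> maxima \<Longrightarrow> a \<in> orbit \<sigma> m \<Longrightarrow> a \<le> m"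
  using maxima_iff Max_ge[OF finite_orbit] by metis

lemma maxima_orbit_eq: "m \<in> maxima \<Longrightarrow> m' \<in> maxima \<Longrightarrow> m' \<in> orbit \<sigma> m \<Longrightarrow> m' = m"
  using maxima_iff orbit_eq by metis

text \<open>Two orbits with the same maximum share an element and so coincide.\<close>

lemma card_maxima: "card maxima = card (cycle_sets n \<sigma>)"
  unfolding maxima_def
proof (rule card_image, rule inj_onI)
  fix A B assume "A \<in> cycle_sets n \<sigma>" "B \<in> cycle_sets n \<sigma>" "Max A = Max B"
  then show "A = B"
    unfolding cycle_sets_def using Max_orbit orbit_eq by (metis imageE)
qed

lemma set_letters: "set letters = {1..n}"
proof -
  have "set letters = (\<Union>m\<in>maxima. orbit \<sigma> m)"
    by (simp only: letters_eq set_concat list.set_map[of "support \<sigma>"] image_image set_support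
        set_sorted_list_of_set[OF finite_maxima])
  also have "\<dots> = {1..n}"
  proof (intro subset_antisym subsetI)
    fix a assume "a \<in> (\<Union>m\<in>maxima. orbit \<sigma> m)"
    then show "a \<in> {1..n}"
      using permutes_orbit_subset[OF permutes] maxima_iff by blast
  next
    fix a assume "a \<in> {1..n}"
    then have "Max (orbit \<sigma> a) \<in> maxima" by (auto simp: maxima_def cycle_sets_def)
    moreover have "a \<in> orbit \<sigma> (Max (orbit \<sigma> a))"
      using orbit_eq[OF Max_orbit] self_in_orbit by simp
    ultimately show "a \<in> (\<Union>m\<in>maxima. orbit \<sigma> m)" by blast
  qed
  finally show ?thesis .
qed

lemma orbit_disjoint:
  assumes "m \<in> maxima" "m' \<in> maxima" "m \<noteq> m'"
  shows "orbit \<sigma> m \<inter> orbit \<sigma> m' = {}"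
proof (rule ccontr)
  assume "orbit \<sigma> m \<inter> orbit \<sigma> m' \<noteq> {}"
  then obtain x where "x \<in> orbit \<sigma> m" "x \<in> orbit \<sigma> m'" by blast
  then have "orbit \<sigma> m = orbit \<sigma> m'" using orbit_eq by metis
  then show False
    using assms maxima_orbit_eq[of m m'] self_in_orbit by blast
qed

lemma distinct_letters: "distinct letters"
  unfolding letters_eq
proof (rule distinct_concat)
  have "m = m'" if "m \<in> maxima" "m' \<in> maxima" "support \<sigma> m = support \<sigma> m'" for m m'
    using that set_support self_in_orbit maxima_orbit_eq by metis
  then show "distinct (map (support \<sigma>) (sorted_list_of_set maxima))"
    using finite_maxima by (simp add: distinct_map inj_on_def)
next
  fix ys assume "ys \<in> set (map (support \<sigma>) (sorted_list_of_set maxima))"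
  then show "distinct ys" using cycle_of_permutation[OF permutation] by auto
next
  fix ys zs
  assume "ys \<in> set (map (support \<sigma>) (sorted_list_of_set maxima))"
    "zs \<in> set (map (support \<sigma>) (sorted_list_of_set maxima))" "ys \<noteq> zs"
  then obtain m m' where "m \<in> maxima" "m' \<in> maxima" "ys = support \<sigma> m" "zs = support \<sigma> m'" "m \<noteq> m'"
    using finite_maxima by auto
  then show "set ys \<inter> set zs = {}"
    using orbit_disjoint by (simp only: set_support)
qed

lemma length_letters: "length letters = n"
  using distinct_card[OF distinct_letters] set_letters by simp

text \<open>\<open>U\<close> holds the letters of the finished cycles; it lies below
  \<open>m\<close> because cycles come by increasing maximum. The current cycle starts with
  \<open>m\<close>, and \<open>q\<close> of its letters precede position \<open>p\<close>.\<close>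

lemma letters_split:
  assumes "p < n"
  obtains U m q where "\<sigma> ` U = U" "\<And>u. u \<in> U \<Longrightarrow> u < m" "m \<in> maxima"
    "q < least_power \<sigma> m" "letters ! p = (\<sigma> ^^ q) m"
    "set (take p letters) = U \<union> (\<lambda>i. (\<sigma> ^^ i) m) ` {..<q}"
    "q > 0 \<Longrightarrow> p > 0 \<and> letters ! (p - 1) = (\<sigma> ^^ (q - 1)) m"
    "Suc q < least_power \<sigma> m \<Longrightarrow> Suc p < n \<and> letters ! Suc p = (\<sigma> ^^ Suc q) m"
proof -
  have "p < length (concat (map (support \<sigma>) (sorted_list_of_set maxima)))"
    using assms length_letters letters_eq by simp
  then obtain ys m zs q where split: "sorted_list_of_set maxima = ys @ m # zs"
    "q < length (support \<sigma> m)" "p = length (concat (map (support \<sigma>) ys)) + q"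
    by (rule nth_concat_split)
  define us where "us = concat (map (support \<sigma>) ys)"
  define vs where "vs = concat (map (support \<sigma>) zs)"
  have letters: "letters = us @ support \<sigma> m @ vs"
    by (simp add: letters_eq split us_def vs_def)
  have p: "p = length us + q" "q < least_power \<sigma> m"
    using split by (simp_all add: us_def)
  have sub: "set ys \<subseteq> maxima" "m \<in> maxima"
    using split(1) finite_maxima set_sorted_list_of_set[of maxima] by auto
  have less: "y < m" if "y \<in> set ys" for y
    using sorted_list_of_set.strict_sorted_key_list_of_set[of maxima] that unfolding split(1)
    by (auto simp: sorted_wrt_append)
  have us: "set us = (\<Union>y\<in>set ys. orbit \<sigma> y)"
    by (simp only: us_def set_concat list.set_map[of "support \<sigma>"] image_image set_support)
  show thesis
  proof (rule that[of "set us" m q])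
    show "\<sigma> ` set us = set us"
      unfolding us image_UN image_orbit ..
    show "u < m" if "u \<in> set us" for u
      using that less sub(1) maxima_ge unfolding us by (meson UN_E le_less_trans subsetD)
    show "m \<in> maxima" "q < least_power \<sigma> m" by fact+
    show "letters ! p = (\<sigma> ^^ q) m"
      using p by (simp add: letters nth_append)
    show "set (take p letters) = set us \<union> (\<lambda>i. (\<sigma> ^^ i) m) ` {..<q}"
      using p by (auto simp: letters take_map)
    show "q > 0 \<Longrightarrow> p > 0 \<and> letters ! (p - 1) = (\<sigma> ^^ (q - 1)) m"
      using p by (auto simp: letters nth_append)
    show "Suc q < least_power \<sigma> m \<Longrightarrow> Suc p < n \<and> letters ! Suc p = (\<sigma> ^^ Suc q) m"
      using p length_letters by (auto simp: letters nth_append)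
  qed
qed

lemma funpow_neq_start:
  assumes "0 < i" "i < least_power \<sigma> m"
  shows "(\<sigma> ^^ i) m \<noteq> m"
proof
  assume "(\<sigma> ^^ i) m = m"
  from least_power_le[OF this assms(1)] show False using assms(2) by simp
qed

text \<open>A cycle maximum in the orbit of \<open>m\<close> is \<open>m\<close> itself, so the
  offset is 0 and the prefix consists of finished cycles only.\<close>

lemma letters_start:
  assumes "p < n" "letters ! p \<in> maxima"
  shows "\<sigma> ` set (take p letters) = set (take p letters)"
    and "\<And>x. x \<in> set (take p letters) \<Longrightarrow> x < letters ! p"
proof -
  obtain U m q where split: "\<sigma> ` U = U" "\<And>u. u \<in> U \<Longrightarrow> u < m" "m \<in> maxima"
    "q < least_power \<sigma> m" "letters ! p = (\<sigma> ^^ q) m"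
    "set (take p letters) = U \<union> (\<lambda>i. (\<sigma> ^^ i) m) ` {..<q}"
    by (rule letters_split[OF assms(1)]) blast
  have "(\<sigma> ^^ q) m = m"
    using assms(2) maxima_orbit_eq[OF split(3)] funpow_in_orbit[OF self_in_orbit] split(5) by simp
  then have "q = 0" using funpow_neq_start split(4) by blast
  then show "\<sigma> ` set (take p letters) = set (take p letters)"
    "\<And>x. x \<in> set (take p letters) \<Longrightarrow> x < letters ! p"
    using split by auto
qed

text \<open>The witness is the maximum of the current cycle. Applying \<open>\<sigma>\<close> shifts
  the part of this cycle already written by one place: its first letter drops out and the letter at
  \<open>p\<close> comes in.\<close>

lemma letters_inner:
  assumes "p < n" "letters ! p \<notin> maxima"
  shows "p > 0" "\<sigma> (letters ! (p - 1)) = letters ! p"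
    and "\<exists>m\<in>set (take p letters). letters ! p < m \<and>
      \<sigma> ` set (take p letters) = insert (letters ! p) (set (take p letters) - {m})"
proof -
  obtain U m q where split: "\<sigma> ` U = U" "\<And>u. u \<in> U \<Longrightarrow> u < m" "m \<in> maxima"
    "q < least_power \<sigma> m" "letters ! p = (\<sigma> ^^ q) m"
    "set (take p letters) = U \<union> (\<lambda>i. (\<sigma> ^^ i) m) ` {..<q}"
    "q > 0 \<Longrightarrow> p > 0 \<and> letters ! (p - 1) = (\<sigma> ^^ (q - 1)) m"
    by (rule letters_split[OF assms(1)]) blast
  have q: "q > 0" using split assms(2) by (cases q) auto
  with split(7) show "p > 0" by simp
  have "\<sigma> ((\<sigma> ^^ (q - 1)) m) = (\<sigma> ^^ q) m"
    using q by (cases q) auto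
  then show "\<sigma> (letters ! (p - 1)) = letters ! p"
    using split(5,7) q by simp
  have "(\<sigma> ^^ q) m \<le> m"
    using maxima_ge[OF split(3)] funpow_in_orbit[OF self_in_orbit] by blast
  then have "letters ! p < m"
    using funpow_neq_start[OF q split(4)] split(5) by simp
  moreover have "m \<in> set (take p letters)"
    using q by (auto simp: split(6) image_iff intro!: bexI[of _ 0])
  moreover have "\<sigma> ` set (take p letters) = insert (letters ! p) (set (take p letters) - {m})"
  proof -
    have "\<sigma> ` (\<lambda>i. (\<sigma> ^^ i) m) ` {..<q} = (\<lambda>i. (\<sigma> ^^ i) m) ` Suc ` {..<q}"
      by (simp add: image_image)
    also have "Suc ` {..<q} = insert q {0<..<q}"
    proof (intro subset_antisym subsetI)
      fix i assume "i \<in> insert q {0<..<q}"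
      then show "i \<in> Suc ` {..<q}" using q by (cases i) auto
    qed auto
    finally have "\<sigma> ` set (take p letters) = insert (letters ! p) (U \<union> (\<lambda>i. (\<sigma> ^^ i) m) ` {0<..<q})"
      unfolding split(6) image_Un split(1) by (simp add: split(5))
    also have "U \<union> (\<lambda>i. (\<sigma> ^^ i) m) ` {0<..<q} = set (take p letters) - {m}"
    proof -
      have "{..<q} = insert 0 {0<..<q}" using q by auto
      moreover have "m \<notin> U" using split(2) by blast
      moreover have "m \<notin> (\<lambda>i. (\<sigma> ^^ i) m) ` {0<..<q}"
        using funpow_neq_start[of _ m] split(4) by (metis (no_types, lifting) greaterThanLessThan_iff imageE order_less_trans)
      ultimately show ?thesis unfolding split(6) by auto
    qed
    finally show ?thesis .
  qed
  ultimately show "\<exists>m\<in>set (take p letters). letters ! p < m \<and>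
      \<sigma> ` set (take p letters) = insert (letters ! p) (set (take p letters) - {m})" by blast
qed

text \<open>The last letter of a cycle maps to the maximum, so it is never above its image; any
  other letter maps to the next one.\<close>

lemma letters_deficit:
  assumes "p < n" "\<sigma> (letters ! p) < letters ! p"
  shows "Suc p < n \<and> \<sigma> (letters ! p) = letters ! Suc p"
proof -
  obtain m q where split: "m \<in> maxima" "q < least_power \<sigma> m" "letters ! p = (\<sigma> ^^ q) m"
    "Suc q < least_power \<sigma> m \<Longrightarrow> Suc p < n \<and> letters ! Suc p = (\<sigma> ^^ Suc q) m"
    by (rule letters_split[OF assms(1)]) blast
  show ?thesis
  proof (cases "Suc q < least_power \<sigma> m")
    case False
    then have "Suc q = least_power \<sigma> m" using split(2) by simp
    then have "\<sigma> (letters ! p) = m"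
      using least_power_of_permutation(1)[OF permutation, of m] split(3) by (metis comp_apply funpow.simps(2))
    moreover have "letters ! p \<le> m"
      using maxima_ge[OF split(1)] funpow_in_orbit[OF self_in_orbit] split(3) by simp
    ultimately show ?thesis using assms(2) by simp
  qed (use split in simp)
qed

section \<open>The fundamental bijection as a cycle word\<close>

definition start_positions :: "nat set" where
  "start_positions = {p \<in> {1..n}. fundamental n \<sigma> p \<in> maxima}"

lemma fundamental_nth: "p \<in> {1..n} \<Longrightarrow> fundamental n \<sigma> p = letters ! (p - 1)"
  by (simp add: fundamental_def letters_def)

lemma fundamental_prefix:
  assumes "p \<in> {1..n}"
  shows "fundamental n \<sigma> ` {1..<p} = set (take (p - 1) letters)"
proof -
  have "{1..<p} = Suc ` {..<p - 1}"
    using assms unfolding image_Suc_lessThan by auto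
  then have "fundamental n \<sigma> ` {1..<p} = fundamental n \<sigma> ` Suc ` {..<p - 1}"
    by (rule arg_cong)
  also have "\<dots> = (!) letters ` {..<p - 1}"
    using assms by (auto simp: image_image fundamental_nth intro!: image_cong)
  also have "\<dots> = set (take (p - 1) letters)"
    unfolding lessThan_atLeast0 using assms length_letters by (intro nth_image) auto
  finally show ?thesis .
qed

lemma bij_fundamental: "bij_betw (fundamental n \<sigma>) {1..n} {1..n}"
proof -
  have "bij_betw (\<lambda>p. p - 1) {1..n} {..<n}"
    by (rule bij_betw_byWitness[of _ Suc]) auto
  moreover have "bij_betw ((!) letters) {..<n} {1..n}"
    using bij_betw_nth[OF distinct_letters] length_letters set_letters by simp
  ultimately have "bij_betw (\<lambda>p. letters ! (p - 1)) {1..n} {1..n}"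
    using bij_betw_trans by (fastforce simp: o_def)
  then show ?thesis
    by (rule bij_betw_cong[THEN iffD1, rotated]) (simp add: fundamental_nth)
qed

text \<open>The word takes each cycle maximum exactly once, so starts correspond to maxima and these
  to cycles.\<close>

lemma card_start_positions: "card start_positions = card (cycle_sets n \<sigma>)"
proof -
  have "maxima \<subseteq> fundamental n \<sigma> ` {1..n}"
    using bij_betw_imp_surj_on[OF bij_fundamental] maxima_iff by blast
  then have "fundamental n \<sigma> ` start_positions = maxima"
    unfolding start_positions_def by blast
  moreover have "inj_on (fundamental n \<sigma>) start_positions"
    by (rule inj_on_subset[OF bij_betw_imp_inj_on[OF bij_fundamental]])
      (auto simp: start_positions_def)
  ultimately have "card start_positions = card maxima"
    using card_image by fastforce
  then show ?thesis using card_maxima by simp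
qed

sublocale cycle_word n \<sigma> "fundamental n \<sigma>" start_positions
proof
  show "\<sigma> permutes {1..n}" by (rule permutes)
  show "bij_betw (fundamental n \<sigma>) {1..n} {1..n}" by (rule bij_fundamental)
  show "start_positions \<subseteq> {1..n}" by (auto simp: start_positions_def)
next
  fix p assume p: "p \<in> start_positions"
  then have *: "p \<in> {1..n}" "p - 1 < n" "letters ! (p - 1) \<in> maxima"
    by (auto simp: start_positions_def fundamental_nth)
  show "\<sigma> ` fundamental n \<sigma> ` {1..<p} = fundamental n \<sigma> ` {1..<p}"
    unfolding fundamental_prefix[OF *(1)] by (rule letters_start(1)[OF *(2,3)])
  show "fundamental n \<sigma> q < fundamental n \<sigma> p" if "q \<in> {1..<p}" for q
    using letters_start(2)[OF *(2,3)] that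
    unfolding fundamental_prefix[OF *(1), symmetric] fundamental_nth[OF *(1), symmetric] by blast
next
  fix p assume p: "p \<in> {1..n} - start_positions"
  then have *: "p \<in> {1..n}" "p - 1 < n" "letters ! (p - 1) \<notin> maxima"
    by (auto simp: start_positions_def fundamental_nth)
  \<comment> \<open>List index 0 always holds a cycle maximum, so here \<open>p\<close> is at least
    2 and \<open>p - 1\<close> is a genuine position.\<close>
  have "p - 1 \<in> {1..n}" using letters_inner(1)[OF *(2,3)] * by auto
  then show "\<sigma> (fundamental n \<sigma> (p - 1)) = fundamental n \<sigma> p"
    using letters_inner(2)[OF *(2,3)] *(1) by (simp only: fundamental_nth)
  show "\<exists>m\<in>fundamental n \<sigma> ` {1..<p}. fundamental n \<sigma> p < m \<and>
      \<sigma> ` fundamental n \<sigma> ` {1..<p} = insert (fundamental n \<sigma> p) (fundamental n \<sigma> ` {1..<p} - {m})"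
    unfolding fundamental_prefix[OF *(1)] fundamental_nth[OF *(1)] by (rule letters_inner(3)[OF *(2,3)])
next
  fix i assume i: "i \<in> {1..n}" "\<sigma> (fundamental n \<sigma> i) < fundamental n \<sigma> i"
  then have "i - 1 < n" "Suc (i - 1) = i" by auto
  then show "i < n \<and> \<sigma> (fundamental n \<sigma> i) = fundamental n \<sigma> (Suc i)"
    using letters_deficit[of "i - 1"] i fundamental_nth[of i] fundamental_nth[of "Suc i"] by simp
qed

end

theorem theorem4p4:
  fixes n :: nat and \<sigma> \<tau> :: "nat \<Rightarrow> nat"
  assumes "\<sigma> permutes {1..n}"
    and "\<tau> = fundamental n \<sigma>"
  shows "dp n \<sigma> = refl_length n \<sigma> + pat_2_31 n \<tau> + pat_41_32 n \<tau> + pat_31_42 n \<tau>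
    + stat_B n \<sigma> \<tau> + stat_C n \<sigma> \<tau>"
proof -
  interpret interval_permutation n \<sigma> by unfold_locales (rule assms(1))
  show ?thesis
    using dp_eq unfolding assms(2) refl_length_def card_start_positions .
qed

end
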